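(* Let $A\in\mathbb{R}^{N_x\times N_x}$, $B\in\mathbb{R}^{N_x\times N_u}$, $C\in\mathbb{R}^{N_y\times N_x}$, $D\in\mathbb{R}^{N_y\times N_u}$, and assume that $A$ is Schur stable. Then the following are true. (i) (State feedback.) Consider the plant $x[t+1]=Ax[t]+Bu[t]+d_x[t]$, and let $\{\mathbf{\Phi}_{\mathbf x},\mathbf{\Phi}_{\mathbf u}\}$ be a feasible state-feedback system response for $(A,B)$ with $\mathbf{\Phi}_{\mathbf u}=\sum_{\tau\ge 1}z^{-\tau}\Phi_u[\tau]$. Then the dynamic state-feedback controller $\mathbf u=\mathbf K\mathbf x$ realized via $$\delta[t]=x[t]-Ax[t-1]-Bu[t-1],\qquad u[t]=\sum_{\tau\ge 1}\Phi_u[\tau]\,\delta[t+1-\tau]$$ is internally stabilizing. (ii) (Output feedback.) Consider the plant $x[t+1]=Ax[t]+Bu[t]+d_x[t]$, $y[t]=Cx[t]+Du[t]+d_y[t]$, and let $\{\mathbf{\Phi}_{\mathbf{xx}},\mathbf{\Phi}_{\mathbf{ux}},\mathbf{\Phi}_{\mathbf{xy}},\mathbf{\Phi}_{\mathbf{uy}}\}$ be a feasible output-feedback system response for $(A,B,C)$ with $\mathbf{\Phi}_{\mathbf{uy}}=\sum_{\tau\ge 0}z^{-\tau}\Phi_{uy}[\tau]$. Then the dynamic output-feedback controller $\mathbf u=\mathbf K\mathbf y$ realized via $$\hat x[t+1]=A\hat x[t]+Bu[t],\qquad \delta[t]=y[t]-C\hat x[t]-Du[t],\qquad u[t]=\sum_{\tau\ge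 0}\Phi_{uy}[\tau]\,\delta[t-\tau]$$ is internally stabilizing.
   Context: Discrete time; bold symbols denote $z$-domain signals and transfer matrices. $\mathcal{RH}_\infty$ is the set of stable (all poles in the open unit disc) proper real-rational transfer matrices, and $z^{-1}\mathcal{RH}_\infty\subset\mathcal{RH}_\infty$ is the subset of strictly proper ones. Here $x[t]\in\mathbb{R}^{N_x}$ is the state, $u[t]\in\mathbb{R}^{N_u}$ the control, $y[t]\in\mathbb{R}^{N_y}$ the measured output, and $d_x,d_y$ are disturbances. For a transfer matrix $\mathbf\Phi=\sum_{\tau\ge0}z^{-\tau}\Phi[\tau]$, the matrix $\Phi[\tau]$ is its $\tau$-th spectral component. $\mathbf K$ denotes the (linear) map from $\mathbf x$ (resp. $\mathbf y$) to $\mathbf u$ determined by the displayed controller equations. Feasible state-feedback system response for $(A,B)$: $\mathbf{\Phi}_{\mathbf x},\mathbf{\Phi}_{\mathbf u}\in z^{-1}\mathcal{RH}_\infty$ with $(zI-A)\mathbf{\Phi}_{\mathbf x}-B\mathbf{\Phi}_{\mathbf u}=I$. Feasible output-feedback system response for $(A,B,C)$: $\mathbf{\Phi}_{\mathbf{xx}},\mathbf{\Phi}_{\mathbf{xy}},\mathbf{\Phi}_{\mathbf{ux}}\in z^{-1}\mathcal{RH}_\infty$ and $\mathbf{\Phi}_{\mathbf{uy}}\in\mathcal{RH}_\infty$ with $$\begin{bmatrix}zI-A&-B\end{bmatrix}\begin{bmatrix}\mathbf{\Phi}_{\mathbf{xx}}&\mathbf{\Phi}_{\mathbf{xy}}\\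 \mathbf{\Phi}_{\mathbf{ux}}&\mathbf{\Phi}_{\mathbf{uy}}\end{bmatrix}=\begin{bmatrix}I&0\end{bmatrix},\qquad \begin{bmatrix}\mathbf{\Phi}_{\mathbf{xx}}&\mathbf{\Phi}_{\mathbf{xy}}\\ \mathbf{\Phi}_{\mathbf{ux}}&\mathbf{\Phi}_{\mathbf{uy}}\end{bmatrix}\begin{bmatrix}zI-A\\-C\end{bmatrix}=\begin{bmatrix}I\\0\end{bmatrix}.$$ Internal stability: inject an external perturbation additively into each loop signal; the controller is internally stabilizing if the resulting closed-loop equations determine the internal signals uniquely in terms of the perturbations, and all closed-loop transfer matrices from the perturbations to the internal signals lie in $\mathcal{RH}_\infty$. Explicitly: Output feedback: perturbations $\mathbf d_{\mathbf x},\mathbf d_{\mathbf u},\mathbf d_{\mathbf y},\mathbf d_{\hat{\mathbf x}}$, internal signals $\mathbf x,\mathbf u,\mathbf y,\hat{\mathbf x}$, and equations $z\mathbf x=A\mathbf x+B\mathbf u+\mathbf d_{\mathbf x}$, $\ \mathbf u=\mathbf{\Phi}_{\mathbf{uy}}\left(\mathbf y-C\hat{\mathbf x}-D(\mathbf u-\mathbf d_{\mathbf u})\right)+\mathbf d_{\mathbf u}$, $\ \mathbf y=C\mathbf x+D\mathbf u+\mathbf d_{\mathbf y}$, $\ z\hat{\mathbf x}=A\hat{\mathbf x}+B(\mathbf u-\mathbf d_{\mathbf u})+\mathbf d_{\hat{\mathbf x}}$. State feedback: perturbations $\mathbf d_{\mathbf x},\mathbf d_{\mathbf u},\mathbf d_{\boldsymbol\delta}$,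 internal signals $\mathbf x,\mathbf u,\boldsymbol\delta$, and equations $z\mathbf x=A\mathbf x+B\mathbf u+\mathbf d_{\mathbf x}$, $\ \boldsymbol\delta=(I-z^{-1}A)\mathbf x-z^{-1}B(\mathbf u-\mathbf d_{\mathbf u})+\mathbf d_{\boldsymbol\delta}$, $\ \mathbf u=z\mathbf{\Phi}_{\mathbf u}\boldsymbol\delta+\mathbf d_{\mathbf u}$. *)

theory Defs
  imports
    "HOL-Analysis.Analysis"
    "HOL-Computational_Algebra.Computational_Algebra"
begin

no_notation fps_nth (infixl "$" 75)

text \<open>
  Both \<open>z\<close>-domain signals and transfer functions are formal Laurent series in the indeterminate
  \<open>fls_X = z\<^sup>-\<^sup>1\<close>.  The coefficient \<open>fls_nth f t\<close> is the value at time \<open>t\<close> of a signal, or the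
  \<open>t\<close>-th spectral component of a transfer function.  Signals are thus arbitrary real sequences on
  the integers that vanish before some finite time; no growth condition is imposed on them.
\<close>

abbreviation zv :: "real fls" where
  "zv \<equiv> fls_X_inv"

abbreviation zv_inv :: "real fls" where
  "zv_inv \<equiv> fls_X"

definition const_mat :: "real ^ 'n ^ 'm \<Rightarrow> real fls ^ 'n ^ 'm" where
  "const_mat = map_matrix fls_const"

definition signal_at :: "real fls ^ 'n \<Rightarrow> int \<Rightarrow> real ^ 'n" where
  "signal_at x t = (\<chi> i. fls_nth (x $ i) t)"

definition spectral_component :: "real fls ^ 'n ^ 'm \<Rightarrow> int \<Rightarrow> real ^ 'n ^ 'm" where
  "spectral_component \<Phi> \<tau> = map_matrix (\<lambda>f. fls_nth f \<tau>) \<Phi>"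


subsection \<open>Stable proper real-rational transfer matrices\<close>

definition poly_z :: "real poly \<Rightarrow> real fls" where
  "poly_z p = poly (map_poly fls_const p) zv"

definition lowest_terms :: "real fls \<Rightarrow> real poly \<Rightarrow> real poly \<Rightarrow> bool" where
  "lowest_terms f p q \<longleftrightarrow> q \<noteq> 0 \<and> coprime p q \<and> f = poly_z p / poly_z q"

definition poles :: "real fls \<Rightarrow> complex set" where
  "poles f = {s. \<exists>p q. lowest_terms f p q \<and> poly (map_poly complex_of_real q) s = 0}"

definition proper_rational :: "real fls \<Rightarrow> bool" where
  "proper_rational f \<longleftrightarrow> (\<exists>p q. lowest_terms f p q \<and> degree p \<le> degree q)"

text \<open>The disjunct \<open>p = 0\<close> is needed because \<open>degree 0 = 0\<close>.\<close>

definition strictly_proper_rational :: "real fls \<Rightarrow> bool" where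
  "strictly_proper_rational f \<longleftrightarrow>
     (\<exists>p q. lowest_terms f p q \<and> (p = 0 \<or> degree p < degree q))"

definition RH_inf :: "(real fls ^ 'n ^ 'm) set" where
  "RH_inf = {\<Phi>. \<forall>i j. proper_rational (\<Phi> $ i $ j) \<and> poles (\<Phi> $ i $ j) \<subseteq> ball 0 1}"

definition zinv_RH_inf :: "(real fls ^ 'n ^ 'm) set" where
  "zinv_RH_inf = {\<Phi> \<in> RH_inf. \<forall>i j. strictly_proper_rational (\<Phi> $ i $ j)}"

definition Schur_stable :: "real ^ 'n ^ 'n \<Rightarrow> bool" where
  "Schur_stable A \<longleftrightarrow>
     (\<forall>l v. v \<noteq> 0 \<and> map_matrix complex_of_real A *v v = l *s v \<longrightarrow> cmod l < 1)"


subsection \<open>Feasible system responses\<close>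

definition sf_feasible ::
  "real ^ 'nx ^ 'nx \<Rightarrow> real ^ 'nu ^ 'nx \<Rightarrow> real fls ^ 'nx ^ 'nx \<Rightarrow> real fls ^ 'nx ^ 'nu \<Rightarrow> bool" where
  "sf_feasible A B \<Phi>x \<Phi>u \<longleftrightarrow>
     \<Phi>x \<in> zinv_RH_inf \<and> \<Phi>u \<in> zinv_RH_inf \<and>
     (mat zv - const_mat A) ** \<Phi>x - const_mat B ** \<Phi>u = mat 1"

definition of_feasible ::
  "real ^ 'nx ^ 'nx \<Rightarrow> real ^ 'nu ^ 'nx \<Rightarrow> real ^ 'nx ^ 'ny \<Rightarrow>
   real fls ^ 'nx ^ 'nx \<Rightarrow> real fls ^ 'nx ^ 'nu \<Rightarrow>
   real fls ^ 'ny ^ 'nx \<Rightarrow> real fls ^ 'ny ^ 'nu \<Rightarrow> bool" where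
  "of_feasible A B C \<Phi>xx \<Phi>ux \<Phi>xy \<Phi>uy \<longleftrightarrow>
     \<Phi>xx \<in> zinv_RH_inf \<and> \<Phi>xy \<in> zinv_RH_inf \<and> \<Phi>ux \<in> zinv_RH_inf \<and> \<Phi>uy \<in> RH_inf \<and>
     (mat zv - const_mat A) ** \<Phi>xx - const_mat B ** \<Phi>ux = mat 1 \<and>
     (mat zv - const_mat A) ** \<Phi>xy - const_mat B ** \<Phi>uy = 0 \<and>
     \<Phi>xx ** (mat zv - const_mat A) - \<Phi>xy ** const_mat C = mat 1 \<and>
     \<Phi>ux ** (mat zv - const_mat A) - \<Phi>uy ** const_mat C = 0"


subsection \<open>Closed loops and internal stability\<close>

text \<open>
  The closed-loop equations with additive perturbations.  Their time-domain form, which for zero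
  perturbations consists of the plant and controller recursions, is proved equivalent in
  \<open>sf_loop_iff_time_domain\<close> and \<open>of_loop_iff_time_domain\<close> below.
\<close>

definition sf_loop ::
  "real ^ 'nx ^ 'nx \<Rightarrow> real ^ 'nu ^ 'nx \<Rightarrow> real fls ^ 'nx ^ 'nu \<Rightarrow>
   real fls ^ 'nx \<Rightarrow> real fls ^ 'nu \<Rightarrow> real fls ^ 'nx \<Rightarrow>
   real fls ^ 'nx \<Rightarrow> real fls ^ 'nu \<Rightarrow> real fls ^ 'nx \<Rightarrow> bool" where
  "sf_loop A B \<Phi>u dx du d\<delta> x u \<delta> \<longleftrightarrow>
     zv *s x = const_mat A *v x + const_mat B *v u + dx \<and>
     \<delta> = (mat 1 - mat zv_inv ** const_mat A) *v x - (mat zv_inv ** const_mat B) *v (u - du) + d\<delta> \<and>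
     u = (mat zv ** \<Phi>u) *v \<delta> + du"

definition of_loop ::
  "real ^ 'nx ^ 'nx \<Rightarrow> real ^ 'nu ^ 'nx \<Rightarrow> real ^ 'nx ^ 'ny \<Rightarrow> real ^ 'nu ^ 'ny \<Rightarrow>
   real fls ^ 'ny ^ 'nu \<Rightarrow>
   real fls ^ 'nx \<Rightarrow> real fls ^ 'nu \<Rightarrow> real fls ^ 'ny \<Rightarrow> real fls ^ 'nx \<Rightarrow>
   real fls ^ 'nx \<Rightarrow> real fls ^ 'nu \<Rightarrow> real fls ^ 'ny \<Rightarrow> real fls ^ 'nx \<Rightarrow> bool" where
  "of_loop A B C D \<Phi>uy dx du dy dxh x u y xh \<longleftrightarrow>
     zv *s x = const_mat A *v x + const_mat B *v u + dx \<and>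
     u = \<Phi>uy *v (y - const_mat C *v xh - const_mat D *v (u - du)) + du \<and>
     y = const_mat C *v x + const_mat D *v u + dy \<and>
     zv *s xh = const_mat A *v xh + const_mat B *v (u - du) + dxh"

definition sf_internally_stabilizing ::
  "real ^ 'nx ^ 'nx \<Rightarrow> real ^ 'nu ^ 'nx \<Rightarrow> real fls ^ 'nx ^ 'nu \<Rightarrow> bool" where
  "sf_internally_stabilizing A B \<Phi>u \<longleftrightarrow>
     (\<forall>dx du d\<delta>. \<exists>!(x, u, \<delta>). sf_loop A B \<Phi>u dx du d\<delta> x u \<delta>) \<and>
     (\<exists>Txx\<in>RH_inf. \<exists>Txu\<in>RH_inf. \<exists>Tx\<delta>\<in>RH_inf.
      \<exists>Tux\<in>RH_inf. \<exists>Tuu\<in>RH_inf. \<exists>Tu\<delta>\<in>RH_inf.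
      \<exists>T\<delta>x\<in>RH_inf. \<exists>T\<delta>u\<in>RH_inf. \<exists>T\<delta>\<delta>\<in>RH_inf.
      \<forall>dx du d\<delta> x u \<delta>. sf_loop A B \<Phi>u dx du d\<delta> x u \<delta> \<longrightarrow>
        x = Txx *v dx + Txu *v du + Tx\<delta> *v d\<delta> \<and>
        u = Tux *v dx + Tuu *v du + Tu\<delta> *v d\<delta> \<and>
        \<delta> = T\<delta>x *v dx + T\<delta>u *v du + T\<delta>\<delta> *v d\<delta>)"

definition of_internally_stabilizing ::
  "real ^ 'nx ^ 'nx \<Rightarrow> real ^ 'nu ^ 'nx \<Rightarrow> real ^ 'nx ^ 'ny \<Rightarrow> real ^ 'nu ^ 'ny \<Rightarrow>
   real fls ^ 'ny ^ 'nu \<Rightarrow> bool" where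
  "of_internally_stabilizing A B C D \<Phi>uy \<longleftrightarrow>
     (\<forall>dx du dy dxh. \<exists>!(x, u, y, xh). of_loop A B C D \<Phi>uy dx du dy dxh x u y xh) \<and>
     (\<exists>Txx\<in>RH_inf. \<exists>Txu\<in>RH_inf. \<exists>Txy\<in>RH_inf. \<exists>Txh\<in>RH_inf.
      \<exists>Tux\<in>RH_inf. \<exists>Tuu\<in>RH_inf. \<exists>Tuy\<in>RH_inf. \<exists>Tuh\<in>RH_inf.
      \<exists>Tyx\<in>RH_inf. \<exists>Tyu\<in>RH_inf. \<exists>Tyy\<in>RH_inf. \<exists>Tyh\<in>RH_inf.
      \<exists>Thx\<in>RH_inf. \<exists>Thu\<in>RH_inf. \<exists>Thy\<in>RH_inf. \<exists>Thh\<in>RH_inf.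
      \<forall>dx du dy dxh x u y xh. of_loop A B C D \<Phi>uy dx du dy dxh x u y xh \<longrightarrow>
        x = Txx *v dx + Txu *v du + Txy *v dy + Txh *v dxh \<and>
        u = Tux *v dx + Tuu *v du + Tuy *v dy + Tuh *v dxh \<and>
        y = Tyx *v dx + Tyu *v du + Tyy *v dy + Tyh *v dxh \<and>
        xh = Thx *v dx + Thu *v du + Thy *v dy + Thh *v dxh)"


subsection \<open>Time-domain form of the loop equations\<close>

lemma signal_eq_iff: "x = y \<longleftrightarrow> (\<forall>t. signal_at x t = signal_at y t)"
  by (auto simp: signal_at_def vec_eq_iff fls_eq_iff)

lemma signal_at_add [simp]: "signal_at (x + y) t = signal_at x t + signal_at y t"
  and signal_at_diff [simp]: "signal_at (x - y) t = signal_at x t - signal_at y t"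
  and signal_at_zv [simp]: "signal_at (zv *s x) t = signal_at x (t + 1)"
  and signal_at_zv_inv [simp]: "signal_at (zv_inv *s x) t = signal_at x (t - 1)"
  by (simp_all add: signal_at_def vec_eq_iff fls_X_inv_times_conv_shift fls_X_times_conv_shift)

lemma fls_nth_sum': "fls_nth (sum f S) t = (\<Sum>i\<in>S. fls_nth (f i) t)"
  by (induction S rule: infinite_finite_induct) simp_all

lemma signal_at_const_mat [simp]: "signal_at (const_mat M *v x) t = M *v signal_at x t"
  by (simp add: signal_at_def const_mat_def vec_eq_iff matrix_vector_mult_def fls_nth_sum')

lemma mat_scalar_mult_vec: "mat c *v x = c *s (x :: 'a :: comm_semiring_1 ^ 'n)"
  by (simp add: vec_eq_iff matrix_vector_mult_def mat_def if_distrib if_distribR cong: if_cong)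

lemma poly_z_nth: "fls_nth (poly_z p) t = (if t \<le> 0 then coeff p (nat (- t)) else 0)"
proof -
  have "poly_z p = (\<Sum>i\<le>degree p. fls_const (coeff p i) * zv ^ i)"
    unfolding poly_z_def poly_altdef by (simp add: coeff_map_poly degree_map_poly)
  hence "fls_nth (poly_z p) t = (\<Sum>i\<le>degree p. if i = nat (- t) \<and> t \<le> 0 then coeff p i else 0)"
    by (auto simp: fls_nth_sum' intro!: sum.cong)
  also have "\<dots> = (if t \<le> 0 then coeff p (nat (- t)) else 0)"
    by (auto simp: coeff_eq_0 sum.delta')
  finally show ?thesis .
qed

lemma fls_subdegree_poly_z: "p \<noteq> 0 \<Longrightarrow> fls_subdegree (poly_z p) = - int (degree p)"
  by (rule fls_subdegree_eqI) (auto simp: poly_z_nth intro!: coeff_eq_0)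

lemma poly_z_eq_0_iff [simp]: "poly_z p = 0 \<longleftrightarrow> p = 0"
proof
  assume "poly_z p = 0"
  hence "fls_nth (poly_z p) (- int (degree p)) = 0" by simp
  thus "p = 0" by (simp add: poly_z_nth)
qed (simp add: poly_z_def)

lemma fls_subdegree_lowest_terms:
  assumes "lowest_terms f p q" "p \<noteq> 0"
  shows "fls_subdegree f = int (degree q) - int (degree p)"
proof -
  have q: "q \<noteq> 0" and f: "f = poly_z p / poly_z q"
    using assms by (auto simp: lowest_terms_def)
  hence eq: "f * poly_z q = poly_z p" and "f \<noteq> 0" using assms by auto
  have "fls_subdegree (f * poly_z q) = fls_subdegree f + fls_subdegree (poly_z q)"
    using q \<open>f \<noteq> 0\<close> by simp
  thus ?thesis using eq q assms(2) by (simp add: fls_subdegree_poly_z)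
qed

lemma proper_rational_nth: "proper_rational f \<Longrightarrow> t < 0 \<Longrightarrow> fls_nth f t = 0"
proof -
  assume "proper_rational f" "t < 0"
  then obtain p q where pq: "lowest_terms f p q" "degree p \<le> degree q"
    by (auto simp: proper_rational_def)
  show ?thesis
  proof (cases "p = 0")
    case True
    hence "f = 0" using pq by (simp add: lowest_terms_def poly_z_def)
    thus ?thesis by simp
  next
    case False
    show ?thesis
      by (rule fls_eq0_below_subdegree)
        (use fls_subdegree_lowest_terms[OF pq(1) False] pq(2) \<open>t < 0\<close> in linarith)
  qed
qed

lemma strictly_proper_rational_nth: "strictly_proper_rational f \<Longrightarrow> t < 1 \<Longrightarrow> fls_nth f t = 0"
proof -
  assume "strictly_proper_rational f" "t < 1"
  then obtain p q where pq: "lowest_terms f p q" "p = 0 \<or> degree p < degree q"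
    by (auto simp: strictly_proper_rational_def)
  show ?thesis
  proof (cases "p = 0")
    case True
    hence "f = 0" using pq by (simp add: lowest_terms_def poly_z_def)
    thus ?thesis by simp
  next
    case False
    hence "degree p < degree q" using pq by blast
    show ?thesis
      by (rule fls_eq0_below_subdegree)
        (use fls_subdegree_lowest_terms[OF pq(1) False] \<open>degree p < degree q\<close> \<open>t < 1\<close> in linarith)
  qed
qed

lemma fls_mult_sums:
  fixes f g :: "real fls"
  assumes "\<And>t. t < 0 \<Longrightarrow> fls_nth f t = 0"
  shows "(\<lambda>k. fls_nth f (int k) * fls_nth g (t - int k)) sums fls_nth (f * g) t"
proof -
  define N where "N = nat (t - fls_subdegree g)"
  have "fls_nth (f * g) t =
      (\<Sum>i=fls_subdegree f..t - fls_subdegree g. fls_nth f i * fls_nth g (t - i))"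
    by (rule fls_times_nth(2))
  also have "\<dots> = (\<Sum>i\<in>int ` {..N}. fls_nth f i * fls_nth g (t - i))"
  proof (rule sum.mono_neutral_cong)
    fix i assume "i \<in> {fls_subdegree f..t - fls_subdegree g} - int ` {..N}"
    hence "i < 0"
      unfolding N_def by (smt (verit, best) DiffE atLeastAtMost_iff atMost_iff imageI int_nat_eq nat_mono)
    thus "fls_nth f i * fls_nth g (t - i) = 0" using assms by simp
  next
    fix i assume "i \<in> int ` {..N} - {fls_subdegree f..t - fls_subdegree g}"
    hence "i < fls_subdegree f \<or> t - i < fls_subdegree g" by auto
    thus "fls_nth f i * fls_nth g (t - i) = 0"
      by auto
  qed auto
  also have "\<dots> = (\<Sum>k\<le>N. fls_nth f (int k) * fls_nth g (t - int k))"
    by (simp add: sum.reindex)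
  finally have eq: "fls_nth (f * g) t = (\<Sum>k\<le>N. fls_nth f (int k) * fls_nth g (t - int k))" .
  show ?thesis unfolding eq
  proof (rule sums_finite)
    fix k assume "k \<notin> {..N}"
    hence "t - int k < fls_subdegree g" unfolding N_def by auto
    thus "fls_nth f (int k) * fls_nth g (t - int k) = 0" by simp
  qed simp
qed

lemma sums_vec_iff: "(f :: nat \<Rightarrow> real ^ 'n) sums s \<longleftrightarrow> (\<forall>i. (\<lambda>k. f k $ i) sums (s $ i))"
proof
  assume "f sums s"
  thus "\<forall>i. (\<lambda>k. f k $ i) sums (s $ i)"
    by (auto intro: bounded_linear.sums[OF bounded_linear_vec_nth])
next
  assume "\<forall>i. (\<lambda>k. f k $ i) sums (s $ i)"
  thus "f sums s" unfolding sums_def by (intro vec_tendstoI) (simp add: sum_component)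
qed

lemma signal_at_convolution:
  assumes "\<And>i j t. t < 0 \<Longrightarrow> fls_nth (\<Phi> $ i $ j) t = 0"
  shows "(\<lambda>k. spectral_component \<Phi> (int k) *v signal_at d (t - int k)) sums signal_at (\<Phi> *v d) t"
  unfolding sums_vec_iff
proof
  fix i
  have "(\<lambda>k. \<Sum>j\<in>UNIV. fls_nth (\<Phi> $ i $ j) (int k) * fls_nth (d $ j) (t - int k)) sums
          (\<Sum>j\<in>UNIV. fls_nth (\<Phi> $ i $ j * d $ j) t)"
    by (intro sums_sum fls_mult_sums assms)
  thus "(\<lambda>k. (spectral_component \<Phi> (int k) *v signal_at d (t - int k)) $ i) sums
          (signal_at (\<Phi> *v d) t $ i)"
    by (simp add: signal_at_def spectral_component_def matrix_vector_mult_def fls_nth_sum')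
qed

theorem sf_loop_iff_time_domain:
  assumes "\<Phi>u \<in> zinv_RH_inf"
  shows "sf_loop A B \<Phi>u dx du d\<delta> x u \<delta> \<longleftrightarrow>
    (\<forall>t. signal_at x (t + 1) = A *v signal_at x t + B *v signal_at u t + signal_at dx t) \<and>
    (\<forall>t. signal_at \<delta> t = signal_at x t - A *v signal_at x (t - 1)
           - B *v (signal_at u (t - 1) - signal_at du (t - 1)) + signal_at d\<delta> t) \<and>
    (\<forall>t. signal_at u t =
           (\<Sum>k. spectral_component \<Phi>u (int (k + 1)) *v signal_at \<delta> (t + 1 - int (k + 1)))
           + signal_at du t)"
proof -
  have nth: "fls_nth (\<Phi>u $ i $ j) t = 0" if "t < 1" for i j t
    using assms that by (auto simp: zinv_RH_inf_def intro: strictly_proper_rational_nth)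
  have conv: "signal_at ((mat zv ** \<Phi>u) *v \<delta>) t =
      (\<Sum>k. spectral_component \<Phi>u (int (k + 1)) *v signal_at \<delta> (t + 1 - int (k + 1)))" for t
  proof -
    have comp: "(mat zv ** \<Phi>u) $ i $ j = fls_shift 1 (\<Phi>u $ i $ j)" for i j
      by (simp add: matrix_matrix_mult_def mat_def if_distrib if_distribR
          fls_X_inv_times_conv_shift cong: if_cong)
    have "(\<lambda>k. spectral_component (mat zv ** \<Phi>u) (int k) *v signal_at \<delta> (t - int k))
             sums signal_at ((mat zv ** \<Phi>u) *v \<delta>) t"
      by (rule signal_at_convolution) (simp add: comp nth)
    moreover have "spectral_component (mat zv ** \<Phi>u) (int k) = spectral_component \<Phi>u (int (k + 1))"
      for k by (simp add: spectral_component_def vec_eq_iff comp add.commute)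
    ultimately show ?thesis by (simp add: sums_iff)
  qed
  have "(mat 1 - mat zv_inv ** const_mat A) *v x = x - zv_inv *s (const_mat A *v x)"
    by (simp add: matrix_vector_mult_diff_rdistrib mat_scalar_mult_vec
        flip: matrix_vector_mul_assoc)
  moreover have "(mat zv_inv ** const_mat B) *v v = zv_inv *s (const_mat B *v v)" for v
    by (simp add: mat_scalar_mult_vec flip: matrix_vector_mul_assoc)
  ultimately show ?thesis
    unfolding sf_loop_def signal_eq_iff by (simp add: conv)
qed

theorem of_loop_iff_time_domain:
  assumes "\<Phi>uy \<in> RH_inf"
  shows "of_loop A B C D \<Phi>uy dx du dy dxh x u y xh \<longleftrightarrow>
    (\<forall>t. signal_at x (t + 1) = A *v signal_at x t + B *v signal_at u t + signal_at dx t) \<and>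
    (\<forall>t. signal_at y t = C *v signal_at x t + D *v signal_at u t + signal_at dy t) \<and>
    (\<forall>t. signal_at xh (t + 1) =
           A *v signal_at xh t + B *v (signal_at u t - signal_at du t) + signal_at dxh t) \<and>
    (\<exists>\<delta>. (\<forall>t. signal_at \<delta> t =
                 signal_at y t - C *v signal_at xh t - D *v (signal_at u t - signal_at du t)) \<and>
         (\<forall>t. signal_at u t =
                 (\<Sum>k. spectral_component \<Phi>uy (int k) *v signal_at \<delta> (t - int k))
                 + signal_at du t))"
proof -
  have conv: "signal_at (\<Phi>uy *v \<delta>) t =
      (\<Sum>k. spectral_component \<Phi>uy (int k) *v signal_at \<delta> (t - int k))" for \<delta> t
    using signal_at_convolution[of \<Phi>uy \<delta> t] assms
    by (auto simp: sums_iff RH_inf_def proper_rational_nth)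
  have "(\<exists>\<delta>. (\<forall>t. signal_at \<delta> t =
                 signal_at y t - C *v signal_at xh t - D *v (signal_at u t - signal_at du t)) \<and>
         (\<forall>t. signal_at u t =
                 (\<Sum>k. spectral_component \<Phi>uy (int k) *v signal_at \<delta> (t - int k))
                 + signal_at du t))
      \<longleftrightarrow> (\<exists>\<delta>. \<delta> = y - const_mat C *v xh - const_mat D *v (u - du) \<and> u = \<Phi>uy *v \<delta> + du)"
    unfolding signal_eq_iff by (simp add: conv)
  also have "\<dots> \<longleftrightarrow> u = \<Phi>uy *v (y - const_mat C *v xh - const_mat D *v (u - du)) + du"
    by blast
  finally have ctrl: "(\<exists>\<delta>. (\<forall>t. signal_at \<delta> t =
                 signal_at y t - C *v signal_at xh t - D *v (signal_at u t - signal_at du t)) \<and>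
         (\<forall>t. signal_at u t =
                 (\<Sum>k. spectral_component \<Phi>uy (int k) *v signal_at \<delta> (t - int k))
                 + signal_at du t))
      \<longleftrightarrow> u = \<Phi>uy *v (y - const_mat C *v xh - const_mat D *v (u - du)) + du" .
  show ?thesis unfolding ctrl of_loop_def
    using signal_eq_iff[of "zv *s x"] signal_eq_iff[of y] signal_eq_iff[of "zv *s xh"]
    by (simp, blast)
qed

end

theory Submission
  imports
    Defs
    "HOL-Computational_Algebra.Field_as_Ring"
begin

text \<open>
  Since \<open>A\<close> is Schur stable, \<open>M = (zI - A)\<^sup>-\<^sup>1\<close> lies in \<open>RH_inf\<close>: by Cramer's rule its entries are
  fractions with denominator \<open>det (zI - A)\<close>, whose roots are eigenvalues of \<open>A\<close>, and they are
  causal because \<open>x[t + 1] = A x[t] + w[t]\<close> propagates zeros forward in time.  In the closed loops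
  the plant dynamics cancel from the signal \<open>\<delta>\<close> fed to the controller: with state feedback
  \<open>\<delta> = z\<^sup>-\<^sup>1 d\<^sub>x + z\<^sup>-\<^sup>1 B d\<^sub>u + d\<^sub>\<delta>\<close>, and with output feedback \<open>x - xh = M (d\<^sub>x - d\<^sub>h + B d\<^sub>u)\<close>.
  Hence all internal signals are obtained explicitly from the perturbations by sums and products
  of stable transfer matrices.
\<close>

subsection \<open>The ring of stable proper rational functions\<close>

text \<open>Scalar counterpart of \<open>RH_inf\<close>: closure of \<open>RH_inf\<close> under
  matrix operations reduces entrywise to closure of this set under ring operations.\<close>

definition stable_proper :: "real fls set" where
  "stable_proper = {f. proper_rational f \<and> poles f \<subseteq> ball 0 1}"

lemma RH_inf_iff: "\<Phi> \<in> RH_inf \<longleftrightarrow> (\<forall>i j. \<Phi> $ i $ j \<in> stable_proper)"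
  by (auto simp: RH_inf_def stable_proper_def)

section \<open>Polynomials in z embedded into Laurent series\<close>

lemma poly_z_add: "poly_z (p + q) = poly_z p + poly_z q"
  by (rule fls_eqI) (simp add: poly_z_nth)

lemma poly_z_diff: "poly_z (p - q) = poly_z p - poly_z q"
  by (rule fls_eqI) (simp add: poly_z_nth)

lemma poly_z_const: "poly_z [:c:] = fls_const c"
  by (simp add: poly_z_def map_poly_pCons)

lemma poly_z_1: "poly_z 1 = 1"
  by (simp add: poly_z_const one_pCons)

lemma poly_z_X: "poly_z [:0, 1:] = zv"
  by (simp add: poly_z_def map_poly_pCons)

lemma poly_z_pCons: "poly_z (pCons a p) = fls_const a + zv * poly_z p"
  by (cases "a = 0 \<and> p = 0") (auto simp: poly_z_def map_poly_pCons)

lemma poly_z_smult: "poly_z (smult c p) = fls_const c * poly_z p"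
  by (rule fls_eqI) (simp add: poly_z_nth)

lemma poly_z_mult: "poly_z (p * q) = poly_z p * poly_z q"
  by (induction p)
    (simp_all add: poly_z_pCons poly_z_smult poly_z_add algebra_simps)

lemma poly_z_inj: "poly_z p = poly_z q \<longleftrightarrow> p = q"
  by (metis poly_z_diff poly_z_eq_0_iff right_minus_eq)

section \<open>Real polynomials with all complex roots in the open unit disc\<close>

definition stable_poly :: "real poly \<Rightarrow> bool" where
  "stable_poly q \<longleftrightarrow> (\<forall>s. poly (map_poly complex_of_real q) s = 0 \<longrightarrow> cmod s < 1)"

lemma map_poly_complex_of_real_mult:
  "map_poly complex_of_real (p * q) = map_poly complex_of_real p * map_poly complex_of_real q"
  by (rule poly_eqI) (simp add: coeff_map_poly coeff_mult)

lemma stable_poly_mult: "stable_poly p \<Longrightarrow> stable_poly q \<Longrightarrow> stable_poly (p * q)"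
  by (auto simp: stable_poly_def map_poly_complex_of_real_mult)

lemma stable_poly_dvd: "stable_poly q \<Longrightarrow> p dvd q \<Longrightarrow> stable_poly p"
  by (auto simp: stable_poly_def map_poly_complex_of_real_mult elim!: dvdE)

text \<open>The zero polynomial vanishes at \<open>1\<close>, which lies outside the open
  disc.\<close>

lemma stable_poly_nonzero: "stable_poly q \<Longrightarrow> q \<noteq> 0"
  unfolding stable_poly_def by (metis map_poly_0 norm_one less_irrefl poly_0)

lemma lowest_terms_exists:
  assumes "q \<noteq> 0"
  obtains p' q' where "lowest_terms (poly_z p / poly_z q) p' q'"
proof -
  have "gcd p q \<noteq> 0" using assms by simp
  then obtain p' q' where *: "p = p' * gcd p q" "q = q' * gcd p q" "coprime p' q'"
    using gcd_coprime_exists by blast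
  have "poly_z (gcd p q) \<noteq> 0" using \<open>gcd p q \<noteq> 0\<close> by simp
  moreover have "poly_z p = poly_z p' * poly_z (gcd p q)" "poly_z q = poly_z q' * poly_z (gcd p q)"
    using *(1,2) by (metis poly_z_mult)+
  ultimately have "poly_z p / poly_z q = poly_z p' / poly_z q'" by simp
  moreover have "q' \<noteq> 0" using *(2) assms by force
  ultimately show ?thesis using * that by (auto simp: lowest_terms_def)
qed

text \<open>The criterion behind the closure properties: \<open>p / q\<close> may be unreduced and
  no degrees are compared. Cancelling common factors can only remove roots of \<open>q\<close>, and
  for rational functions vanishing at negative times amounts to properness.\<close>

lemma stable_properI:
  assumes q: "stable_poly q" and f: "f = poly_z p / poly_z q"
    and causal: "\<And>t. t < 0 \<Longrightarrow> fls_nth f t = 0"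
  shows "f \<in> stable_proper"
proof -
  have q0: "q \<noteq> 0" using q by (rule stable_poly_nonzero)
  obtain p' q' where pq: "lowest_terms f p' q'" using lowest_terms_exists[OF q0] f by metis
  \<comment> \<open>For \<open>p' \<noteq> 0\<close> the difference
    \<open>degree q' - degree p'\<close> is the subdegree of \<open>f\<close>, which causality makes
    nonnegative.\<close>
  have "degree p' \<le> degree q'"
  proof (cases "p' = 0")
    case False
    hence "f \<noteq> 0" using pq by (auto simp: lowest_terms_def)
    hence "fls_subdegree f \<ge> 0" using causal by (meson nth_fls_subdegree_nonzero not_le)
    thus ?thesis using fls_subdegree_lowest_terms[OF pq False] by simp
  qed simp
  hence "proper_rational f" using pq by (auto simp: proper_rational_def)
  \<comment> \<open>\<open>poles\<close> admits every representation in lowest terms, so an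
    arbitrary one is compared with \<open>p / q\<close>: cross-multiplying gives
    \<open>n * q = p * d\<close>, and coprimality makes \<open>d\<close> divide
    \<open>q\<close>.\<close>
  moreover have "stable_poly d" if "lowest_terms f n d" for n d
  proof -
    have "d \<noteq> 0" "coprime n d" "poly_z n / poly_z d = poly_z p / poly_z q"
      using that f by (auto simp: lowest_terms_def)
    hence "poly_z n * poly_z q = poly_z p * poly_z d" using q0 by (simp add: field_simps)
    hence "n * q = p * d" by (simp add: poly_z_inj flip: poly_z_mult)
    hence "d dvd q" using \<open>coprime n d\<close>
      by (metis coprime_commute coprime_dvd_mult_right_iff dvd_triv_right)
    thus ?thesis using q stable_poly_dvd by blast
  qed
  ultimately show ?thesis by (auto simp: stable_proper_def poles_def stable_poly_def)
qed

lemma stable_properE: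
  assumes "f \<in> stable_proper"
  obtains p q where "stable_poly q" "q \<noteq> 0" "f = poly_z p / poly_z q"
    "\<forall>t<0. fls_nth f t = 0"
proof -
  obtain p q where pq: "lowest_terms f p q"
    using assms by (auto simp: stable_proper_def proper_rational_def)
  hence "stable_poly q" using assms by (force simp: stable_proper_def poles_def stable_poly_def)
  thus ?thesis using that pq assms
    by (auto simp: stable_proper_def lowest_terms_def dest: proper_rational_nth)
qed

section \<open>Ring operations on stable proper functions\<close>

lemma stable_proper_const: "fls_const c \<in> stable_proper"
  by (rule stable_properI[where p = "[:c:]" and q = 1])
    (auto simp: stable_poly_def poly_z_const poly_z_1)

lemma stable_proper_zv_inv: "zv_inv \<in> stable_proper"
proof (rule stable_properI[where p = 1 and q = "[:0, 1:]"])
  show "zv_inv = poly_z 1 / poly_z [:0, 1:]"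
    by (simp add: poly_z_1 poly_z_X fls_inverse_X_inv divide_inverse)
qed (auto simp: stable_poly_def map_poly_pCons)

lemma stable_proper_add:
  assumes "f \<in> stable_proper" "g \<in> stable_proper"
  shows "f + g \<in> stable_proper"
proof -
  obtain p q where f: "stable_poly q" "q \<noteq> 0" "f = poly_z p / poly_z q"
    "\<forall>t<0. fls_nth f t = 0" using assms(1) by (blast elim: stable_properE)
  obtain r s where g: "stable_poly s" "s \<noteq> 0" "g = poly_z r / poly_z s"
    "\<forall>t<0. fls_nth g t = 0" using assms(2) by (blast elim: stable_properE)
  have "f + g = poly_z (p * s + r * q) / poly_z (q * s)"
    using f(2) g(2) unfolding f(3) g(3) by (simp add: poly_z_add poly_z_mult add_frac_eq)
  moreover have "fls_nth (f + g) t = 0" if "t < 0" for t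
    using f(4) g(4) that by simp
  ultimately show ?thesis using stable_properI[OF stable_poly_mult[OF f(1) g(1)]] by blast
qed

lemma stable_proper_mult:
  assumes "f \<in> stable_proper" "g \<in> stable_proper"
  shows "f * g \<in> stable_proper"
proof -
  obtain p q where f: "stable_poly q" "q \<noteq> 0" "f = poly_z p / poly_z q"
    "\<forall>t<0. fls_nth f t = 0" using assms(1) by (blast elim: stable_properE)
  obtain r s where g: "stable_poly s" "s \<noteq> 0" "g = poly_z r / poly_z s"
    "\<forall>t<0. fls_nth g t = 0" using assms(2) by (blast elim: stable_properE)
  have "f * g = poly_z (p * r) / poly_z (q * s)"
    unfolding f(3) g(3) by (simp add: poly_z_mult)
  moreover have "fls_nth (f * g) t = 0" if "t < 0" for t
  proof -
    \<comment> \<open>For \<open>t < 0\<close> one of the indices \<open>i\<close> and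
      \<open>t - i\<close> is negative, so every term of the convolution vanishes.\<close>
    have "fls_nth f i * fls_nth g (t - i) = 0" for i
      using f(4) g(4) that by (cases "i < 0") auto
    thus ?thesis unfolding fls_times_nth(2) by (intro sum.neutral) blast
  qed
  ultimately show ?thesis using stable_properI[OF stable_poly_mult[OF f(1) g(1)]] by blast
qed

lemma stable_proper_uminus: "f \<in> stable_proper \<Longrightarrow> - f \<in> stable_proper"
  using stable_proper_mult[OF stable_proper_const[of "- 1"], of f] by simp

lemma stable_proper_sum:
  "(\<And>i. i \<in> S \<Longrightarrow> f i \<in> stable_proper) \<Longrightarrow> sum f S \<in> stable_proper"
  using stable_proper_const[of 0]
  by (induction S rule: infinite_finite_induct) (auto intro: stable_proper_add)

text \<open>Multiplication by z advances the sequence by one step and keeps the denominator. Strict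
  properness clears the coefficient at time 0, so the advanced sequence is still causal.\<close>

lemma stable_proper_zv_mult:
  assumes "f \<in> stable_proper" "strictly_proper_rational f"
  shows "zv * f \<in> stable_proper"
proof -
  obtain p q where f: "stable_poly q" "q \<noteq> 0" "f = poly_z p / poly_z q"
    using assms(1) by (blast elim: stable_properE)
  show ?thesis
  proof (rule stable_properI[OF f(1)])
    show "zv * f = poly_z ([:0, 1:] * p) / poly_z q"
      unfolding poly_z_mult poly_z_X by (simp add: f(3))
  qed (use strictly_proper_rational_nth[OF assms(2)] in \<open>simp add: fls_X_inv_times_conv_shift\<close>)
qed

subsection \<open>Stable transfer matrices\<close>

lemma mat_mult_nth: "(mat c ** \<Phi>) $ i $ j = c * \<Phi> $ i $ j"
  by (simp add: matrix_matrix_mult_def mat_def if_distrib if_distribR cong: if_cong)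

lemma RH_inf_add: "\<Phi> \<in> RH_inf \<Longrightarrow> \<Psi> \<in> RH_inf \<Longrightarrow> \<Phi> + \<Psi> \<in> RH_inf"
  by (simp add: RH_inf_iff stable_proper_add)

lemma RH_inf_uminus: "\<Phi> \<in> RH_inf \<Longrightarrow> - \<Phi> \<in> RH_inf"
  by (simp add: RH_inf_iff stable_proper_uminus)

lemma RH_inf_diff: "\<Phi> \<in> RH_inf \<Longrightarrow> \<Psi> \<in> RH_inf \<Longrightarrow> \<Phi> - \<Psi> \<in> RH_inf"
  using RH_inf_add[OF _ RH_inf_uminus] by fastforce

lemma RH_inf_mult: "\<Phi> \<in> RH_inf \<Longrightarrow> \<Psi> \<in> RH_inf \<Longrightarrow> \<Phi> ** \<Psi> \<in> RH_inf"
  by (auto simp: RH_inf_iff matrix_matrix_mult_def intro!: stable_proper_sum stable_proper_mult)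

lemma RH_inf_const_mat: "const_mat M \<in> RH_inf"
  by (simp add: RH_inf_iff const_mat_def stable_proper_const)

lemma RH_inf_mat: "c \<in> stable_proper \<Longrightarrow> mat c \<in> RH_inf"
  using stable_proper_const[of 0] by (simp add: RH_inf_iff mat_def)

lemma RH_inf_mat_1: "mat 1 \<in> RH_inf"
  using RH_inf_mat stable_proper_const[of 1] by simp

lemma RH_inf_zv_mult: "\<Phi> \<in> zinv_RH_inf \<Longrightarrow> mat zv ** \<Phi> \<in> RH_inf"
  by (simp add: zinv_RH_inf_def RH_inf_iff mat_mult_nth stable_proper_zv_mult)

lemmas RH_inf_intros = RH_inf_add RH_inf_diff RH_inf_mult RH_inf_const_mat RH_inf_mat_1 RH_inf_uminus
  RH_inf_mat[OF stable_proper_zv_inv] RH_inf_zv_mult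

subsection \<open>The resolvent of a Schur stable matrix\<close>

text \<open>The determinant is a polynomial in the entries with integer coefficients. This serves
  both for \<open>poly_z\<close> and for evaluation at a complex point.\<close>

lemma det_hom:
  fixes h :: "'a :: comm_ring_1 \<Rightarrow> 'b :: comm_ring_1" and P :: "'a ^ 'n ^ 'n"
  assumes add: "\<And>x y. h (x + y) = h x + h y" and mult: "\<And>x y. h (x * y) = h x * h y"
    and one: "h 1 = 1"
  shows "h (det P) = det (map_matrix h P)"
proof -
  have zero: "h 0 = 0" using add[of 0 0] by simp
  have minus: "h (- x) = - h x" for x
    using add[of x "- x"] zero by (simp add: eq_neg_iff_add_eq_0 add.commute)
  have sum: "h (sum f S) = (\<Sum>i\<in>S. h (f i))" for f :: "('n \<Rightarrow> 'n) \<Rightarrow> 'a" and S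
    by (induction S rule: infinite_finite_induct) (simp_all add: zero add)
  have prod: "h (prod f S) = (\<Prod>i\<in>S. h (f i))" for f :: "'n \<Rightarrow> 'a" and S
    by (induction S rule: infinite_finite_induct) (simp_all add: one mult)
  have sign: "h (of_int (sign p)) = of_int (sign p)" for p :: "'n \<Rightarrow> 'n"
    by (simp add: sign_def one minus)
  show ?thesis by (simp add: det_def sum mult sign prod)
qed

text \<open>The matrix zI - A over the polynomial ring, so that its determinant, the characteristic
  polynomial of \<open>A\<close>, has complex roots to speak of.\<close>

definition char_matrix :: "real ^ 'n ^ 'n \<Rightarrow> real poly ^ 'n ^ 'n" where
  "char_matrix A = mat [:0, 1:] - map_matrix (\<lambda>a. [:a:]) A"

lemma map_matrix_poly_z_char_matrix: "map_matrix poly_z (char_matrix A) = mat zv - const_mat A"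
  by (simp add: vec_eq_iff char_matrix_def mat_def const_mat_def poly_z_diff poly_z_const poly_z_X)

text \<open>At a root \<open>s\<close> the matrix sI - A is singular, and a nonzero kernel vector is
  an eigenvector of \<open>A\<close> for \<open>s\<close>.\<close>

lemma stable_poly_det_char_matrix:
  assumes "Schur_stable A"
  shows "stable_poly (det (char_matrix A))"
  unfolding stable_poly_def
proof (intro allI impI)
  fix s assume s: "poly (map_poly complex_of_real (det (char_matrix A))) s = 0"
  let ?h = "\<lambda>p. poly (map_poly complex_of_real p) s"
  let ?A = "map_matrix complex_of_real A"
  have "map_poly complex_of_real (p + q) = map_poly complex_of_real p + map_poly complex_of_real q"
    for p q by (rule poly_eqI) (simp add: coeff_map_poly)
  hence "?h (det (char_matrix A)) = det (map_matrix ?h (char_matrix A))"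
    by (intro det_hom) (simp_all add: map_poly_complex_of_real_mult)
  also have "map_matrix ?h (char_matrix A) = mat s - ?A"
    by (auto simp: vec_eq_iff char_matrix_def mat_def map_poly_pCons)
  finally have "\<not> invertible (mat s - ?A)" using s by (simp add: invertible_det_nz)
  then obtain v where "v \<noteq> 0" "(mat s - ?A) *v v = 0"
    by (metis invertible_left_inverse matrix_left_invertible_ker)
  hence "?A *v v = s *s v"
    by (simp add: matrix_vector_mult_diff_rdistrib mat_scalar_mult_vec)
  thus "cmod s < 1" using assms \<open>v \<noteq> 0\<close> by (auto simp: Schur_stable_def)
qed

section \<open>Causality of the plant recursion\<close>

lemma signal_vanishes_before: "\<exists>N. \<forall>t<N. signal_at x t = 0"
proof -
  define N where "N = Min (range (\<lambda>i. fls_subdegree (x $ i)))"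
  have "N \<le> fls_subdegree (x $ i)" for i unfolding N_def by (rule Min_le) auto
  hence "\<forall>t<N. signal_at x t = 0"
    by (auto simp: signal_at_def vec_eq_iff intro: fls_eq0_below_subdegree less_le_trans)
  thus ?thesis by blast
qed

text \<open>A Laurent signal is zero in the remote past, so there is no free initial state: the
  trajectory stays zero for as long as its input does.\<close>

lemma plant_causal:
  assumes eq: "zv *s x = const_mat A *v x + w" and w: "\<And>t. t < 0 \<Longrightarrow> signal_at w t = 0"
    and t: "t < 0"
  shows "signal_at x t = 0"
proof -
  obtain N where N: "\<And>t. t < N \<Longrightarrow> signal_at x t = 0" using signal_vanishes_before by blast
  have plant: "signal_at x (t + 1) = A *v signal_at x t + signal_at w t" for t
    using arg_cong[OF eq, of "\<lambda>x. signal_at x t"] by simp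
  show ?thesis
  proof (cases "t < N")
    case False
    \<comment> \<open>The induction starts at \<open>N - 1\<close>, the last time at which
      \<open>N\<close> already guarantees a zero state.\<close>
    hence "N - 1 \<le> t" by simp
    thus ?thesis using t
    proof (induction t rule: int_ge_induct)
      case base
      show ?case by (simp add: N)
    next
      case (step i)
      thus ?case using plant[of i] w[of i] by simp
    qed
  qed (rule N)
qed

text \<open>\<open>M\<close> is the inverse of zI - A over the field of Laurent series; it exists
  because the characteristic polynomial is nonzero. The equivalence gives existence and uniqueness
  of the trajectory for every input.\<close>

lemma resolvent_exists:
  assumes "Schur_stable A"
  obtains M where "M \<in> RH_inf"
    "\<And>x w. zv *s x = const_mat A *v x + w \<longleftrightarrow> x = M *v w"
proof -
  define F where "F = mat zv - const_mat A"
  define q where "q = det (char_matrix A)"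
  have hom: "poly_z (det P) = det (map_matrix poly_z P)" for P :: "real poly ^ 'a ^ 'a"
    by (rule det_hom) (simp_all add: poly_z_add poly_z_mult poly_z_1)
  have q: "stable_poly q" unfolding q_def by (rule stable_poly_det_char_matrix[OF assms])
  have detF: "det F = poly_z q"
    by (simp add: F_def q_def hom map_matrix_poly_z_char_matrix)
  hence F0: "det F \<noteq> 0" using stable_poly_nonzero[OF q] by simp
  then obtain M where M: "F ** M = mat 1" "M ** F = mat 1"
    using invertible_det_nz[of F] by (auto simp: invertible_def)
  have F_eq: "F *v x = w \<longleftrightarrow> x = M *v w" for x w
    using M by (metis matrix_vector_mul_assoc matrix_vector_mul_lid)
  have plant_iff: "zv *s x = const_mat A *v x + w \<longleftrightarrow> F *v x = w" for x w
    by (auto simp: F_def matrix_vector_mult_diff_rdistrib mat_scalar_mult_vec algebra_simps)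
  have "M $ k $ j \<in> stable_proper" for k j
  proof -
    \<comment> \<open>Column \<open>j\<close> of \<open>M\<close> is the state trajectory caused by
      a unit impulse at time 0 in component \<open>j\<close>. Hence \<open>plant_causal\<close>
      applies to it.\<close>
    let ?x = "M *v axis j 1"
    have x: "F *v ?x = axis j 1" by (simp add: F_eq)
    have nth: "?x $ k = M $ k $ j"
      by (simp add: matrix_vector_mult_def axis_def if_distrib cong: if_cong)
    \<comment> \<open>The numerator matrix of Cramer's rule for component \<open>k\<close>, built
      over polynomials so that its determinant is a polynomial in z.\<close>
    define P where "P = (\<chi> i l. if l = k then axis j 1 $ i else char_matrix A $ i $ l)"
    have "map_matrix poly_z P = (\<chi> i l. if l = k then axis j 1 $ i else F $ i $ l)"
      using map_matrix_poly_z_char_matrix[of A]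
      by (auto simp: vec_eq_iff P_def F_def axis_def poly_z_1)
    hence "?x $ k = poly_z (det P) / poly_z q"
      using cramer[OF F0, of ?x "axis j 1"] x by (simp add: hom detF)
    moreover have "fls_nth (?x $ k) t = 0" if "t < 0" for t
    proof -
      have "signal_at ?x t = 0"
        by (rule plant_causal[OF plant_iff[THEN iffD2, OF x] _ that])
          (simp add: signal_at_def axis_def vec_eq_iff)
      thus ?thesis by (simp add: signal_at_def vec_eq_iff)
    qed
    ultimately have "?x $ k \<in> stable_proper" using q by (intro stable_properI) auto
    thus ?thesis by (simp only: nth)
  qed
  hence "M \<in> RH_inf" by (simp add: RH_inf_iff)
  thus ?thesis using that plant_iff F_eq by simp
qed

subsection \<open>Solving the closed loops\<close>

lemma matrix_vector_mult_uminus: "(- X) *v y = - (X *v (y :: 'a :: ring_1 ^ 'n))"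
  by (simp add: matrix_vector_mult_def vec_eq_iff sum_negf)

lemmas matrix_vector_expand = matrix_vector_right_distrib matrix_vector_mult_add_rdistrib
  matrix_vector_mult_diff_distrib matrix_vector_mult_diff_rdistrib matrix_vector_mult_uminus

text \<open>A triangular form of the loop: \<delta> depends on the perturbations only, then
  \<open>u\<close> on \<delta>, then \<open>x\<close> on \<open>u\<close>. Being an equivalence, it
  also yields unique solvability.\<close>

lemma sf_loop_solution:
  assumes M: "\<And>x w. zv *s x = const_mat A *v x + w \<longleftrightarrow> x = M *v w"
  shows "sf_loop A B \<Phi>u dx du d\<delta> x u \<delta> \<longleftrightarrow>
    \<delta> = zv_inv *s (dx + const_mat B *v du) + d\<delta> \<and>
    u = (mat zv ** \<Phi>u) *v \<delta> + du \<and>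
    x = M *v (const_mat B *v u + dx)"
proof -
  have "(mat 1 - mat zv_inv ** const_mat A) *v x - (mat zv_inv ** const_mat B) *v (u - du)
      = zv_inv *s (dx + const_mat B *v du)"
    if eq: "zv *s x = const_mat A *v x + (const_mat B *v u + dx)"
  proof -
    \<comment> \<open>Dividing the plant equation by z expresses \<open>x\<close> through delayed
      signals; the delayed \<open>A\<close>-term and \<open>u\<close>-term then cancel, leaving
      \<open>dx\<close> and the \<open>du\<close>-term.\<close>
    have "zv_inv * zv = 1" by (simp flip: fls_inverse_X)
    hence "zv_inv *s (zv *s x) = x" by (simp add: vector_smult_assoc)
    hence "x = zv_inv *s (const_mat A *v x + (const_mat B *v u + dx))"
      by (simp only: eq)
    thus ?thesis
      by (simp add: matrix_vector_expand mat_scalar_mult_vec vec.scale_right_distrib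
          vec.scale_right_diff_distrib algebra_simps flip: matrix_vector_mul_assoc)
  qed
  thus ?thesis unfolding sf_loop_def add.assoc M[symmetric] by auto
qed

text \<open>Plant and observer are driven by \<open>u\<close> and \<open>u - du\<close>, so the
  control cancels in \<open>x - xh\<close>; the \<open>D\<close>-terms cancel likewise up to
  \<open>du\<close>. The controller input thus depends on perturbations only, and the loop is solved
  in the order \<open>u\<close>, then \<open>x\<close> and \<open>xh\<close>, then
  \<open>y\<close>.\<close>

lemma of_loop_solution:
  assumes M: "\<And>x w. zv *s x = const_mat A *v x + w \<longleftrightarrow> x = M *v w"
  shows "of_loop A B C D \<Phi>uy dx du dy dxh x u y xh \<longleftrightarrow>
    u = \<Phi>uy *v (const_mat C *v (M *v (const_mat B *v du + dx - dxh)) + const_mat D *v du + dy) + du \<and>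
    x = M *v (const_mat B *v u + dx) \<and>
    y = const_mat C *v x + const_mat D *v u + dy \<and>
    xh = M *v (const_mat B *v (u - du) + dxh)"
proof -
  have ctrl: "u = \<Phi>uy *v (y - const_mat C *v xh - const_mat D *v (u - du)) + du \<longleftrightarrow>
    u = \<Phi>uy *v (const_mat C *v (M *v (const_mat B *v du + dx - dxh)) + const_mat D *v du + dy) + du"
    if x: "x = M *v (const_mat B *v u + dx)" and y: "y = const_mat C *v x + const_mat D *v u + dy"
      and xh: "xh = M *v (const_mat B *v (u - du) + dxh)"
  proof -
    have "const_mat C *v (M *v (const_mat B *v du + dx - dxh)) = const_mat C *v x - const_mat C *v xh"
      unfolding x xh by (simp add: matrix_vector_expand algebra_simps)
    hence "y - const_mat C *v xh - const_mat D *v (u - du) =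
        const_mat C *v (M *v (const_mat B *v du + dx - dxh)) + const_mat D *v du + dy"
      unfolding y by (simp add: matrix_vector_expand)
    thus ?thesis by (simp only:)
  qed
  have "zv *s x = const_mat A *v x + const_mat B *v u + dx \<longleftrightarrow> x = M *v (const_mat B *v u + dx)"
    "zv *s xh = const_mat A *v xh + const_mat B *v (u - du) + dxh \<longleftrightarrow>
      xh = M *v (const_mat B *v (u - du) + dxh)"
    by (simp_all add: add.assoc M)
  thus ?thesis unfolding of_loop_def using ctrl by blast
qed

section \<open>Closed-loop transfer matrices\<close>

lemma sf_internally_stabilizing_if_stable:
  assumes "Schur_stable A" and \<Phi>u: "\<Phi>u \<in> zinv_RH_inf"
  shows "sf_internally_stabilizing A B \<Phi>u"
proof -
  obtain M where M: "M \<in> RH_inf" "\<And>x w. zv *s x = const_mat A *v x + w \<longleftrightarrow> x = M *v w"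
    using resolvent_exists[OF assms(1)] by blast
  note sol = sf_loop_solution[OF M(2)]
  \<comment> \<open>\<open>Z\<close> is the controller from \<delta> to \<open>u\<close>, stable
    because \<open>\<Phi>u\<close> is strictly proper. \<open>Tdx\<close> and \<open>Tdu\<close>
    lead from \<open>dx\<close> and \<open>du\<close> to \<delta>; composing with \<open>Z\<close>,
    plus the direct injection of \<open>du\<close>, gives \<open>Tux\<close> and
    \<open>Tuu\<close>.\<close>
  define Z where "Z = mat zv ** \<Phi>u"
  define b where "b = const_mat B"
  define Tdx where "Tdx = (mat zv_inv :: real fls ^ 'a ^ 'a)"
  define Tdu where "Tdu = Tdx ** b"
  define Tux where "Tux = Z ** Tdx"
  define Tuu where "Tuu = Z ** Tdu + mat 1"
  have mem: "Z \<in> RH_inf" "b \<in> RH_inf" "Tdx \<in> RH_inf" "Tdu \<in> RH_inf" "Tux \<in> RH_inf" "Tuu \<in> RH_inf"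
    unfolding Z_def b_def Tdx_def Tdu_def Tux_def Tuu_def by (intro RH_inf_intros \<Phi>u)+
  show ?thesis
    unfolding sf_internally_stabilizing_def
  proof (intro conjI allI)
    show "\<exists>!(x, u, \<delta>). sf_loop A B \<Phi>u dx du d\<delta> x u \<delta>" for dx du d\<delta>
      unfolding sol by auto
    have resp: "x = (M ** b ** Tux + M) *v dx + (M ** b ** Tuu) *v du + (M ** b ** Z) *v d\<delta> \<and>
        u = Tux *v dx + Tuu *v du + Z *v d\<delta> \<and>
        \<delta> = Tdx *v dx + Tdu *v du + mat 1 *v d\<delta>"
      if "sf_loop A B \<Phi>u dx du d\<delta> x u \<delta>" for dx du d\<delta> x u \<delta>
    proof -
      have "\<delta> = Tdx *v (dx + b *v du) + d\<delta>" "u = Z *v \<delta> + du" "x = M *v (b *v u + dx)"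
        using that unfolding sol by (simp_all add: b_def Z_def Tdx_def mat_scalar_mult_vec)
      thus ?thesis
        by (simp add: Tdu_def Tux_def Tuu_def matrix_vector_expand algebra_simps
            flip: matrix_vector_mul_assoc)
    qed
    show "\<exists>Txx\<in>RH_inf. \<exists>Txu\<in>RH_inf. \<exists>Tx\<delta>\<in>RH_inf.
      \<exists>Tux\<in>RH_inf. \<exists>Tuu\<in>RH_inf. \<exists>Tu\<delta>\<in>RH_inf.
      \<exists>T\<delta>x\<in>RH_inf. \<exists>T\<delta>u\<in>RH_inf. \<exists>T\<delta>\<delta>\<in>RH_inf.
      \<forall>dx du d\<delta> x u \<delta>. sf_loop A B \<Phi>u dx du d\<delta> x u \<delta> \<longrightarrow>
        x = Txx *v dx + Txu *v du + Tx\<delta> *v d\<delta> \<and>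
        u = Tux *v dx + Tuu *v du + Tu\<delta> *v d\<delta> \<and>
        \<delta> = T\<delta>x *v dx + T\<delta>u *v du + T\<delta>\<delta> *v d\<delta>"
      by (rule bexI[where x = "M ** b ** Tux + M"], rule bexI[where x = "M ** b ** Tuu"],
          rule bexI[where x = "M ** b ** Z"], rule bexI[where x = Tux], rule bexI[where x = Tuu],
          rule bexI[where x = Z], rule bexI[where x = Tdx], rule bexI[where x = Tdu],
          rule bexI[where x = "mat 1"], use resp in blast)
        (intro RH_inf_intros M mem)+
  qed
qed

lemma of_internally_stabilizing_if_stable:
  assumes "Schur_stable A" and \<Phi>: "\<Phi>uy \<in> RH_inf"
  shows "of_internally_stabilizing A B C D \<Phi>uy"
proof -
  obtain M where M: "M \<in> RH_inf" "\<And>x w. zv *s x = const_mat A *v x + w \<longleftrightarrow> x = M *v w"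
    using resolvent_exists[OF assms(1)] by blast
  note sol = of_loop_solution[OF M(2)]
  define b where "b = const_mat B"
  define c where "c = const_mat C"
  define d where "d = const_mat D"
  define Tux where "Tux = \<Phi>uy ** c ** M"
  define Tuu where "Tuu = \<Phi>uy ** (c ** M ** b + d) + mat 1"
  \<comment> \<open>\<open>G\<close> and \<open>H\<close> are the open-loop plant responses from
    \<open>u\<close> to \<open>x\<close> and from \<open>u\<close> to \<open>y\<close>. Every row
    for \<open>x\<close>, \<open>y\<close> and \<open>xh\<close> is the row for \<open>u\<close>
    composed with one of them, plus direct terms.\<close>
  define G where "G = M ** b"
  define H where "H = c ** G + d"
  have mem: "b \<in> RH_inf" "c \<in> RH_inf" "d \<in> RH_inf" "Tux \<in> RH_inf" "Tuu \<in> RH_inf"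
    "G \<in> RH_inf" "H \<in> RH_inf"
    unfolding b_def c_def d_def Tux_def Tuu_def G_def H_def by (intro RH_inf_intros M \<Phi>)+
  show ?thesis
    unfolding of_internally_stabilizing_def
  proof (intro conjI allI)
    show "\<exists>!(x, u, y, xh). of_loop A B C D \<Phi>uy dx du dy dxh x u y xh" for dx du dy dxh
      unfolding sol by auto
    have resp: "x = (G ** Tux + M) *v dx + (G ** Tuu) *v du + (G ** \<Phi>uy) *v dy
            + (- (G ** Tux)) *v dxh \<and>
        u = Tux *v dx + Tuu *v du + \<Phi>uy *v dy + (- Tux) *v dxh \<and>
        y = (H ** Tux + c ** M) *v dx + (H ** Tuu) *v du + (H ** \<Phi>uy + mat 1) *v dy
            + (- (H ** Tux)) *v dxh \<and>
        xh = (G ** Tux) *v dx + (G ** Tuu - G) *v du + (G ** \<Phi>uy) *v dy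
            + (M - G ** Tux) *v dxh"
      if "of_loop A B C D \<Phi>uy dx du dy dxh x u y xh" for dx du dy dxh x u y xh
    proof -
      have eqs: "u = \<Phi>uy *v (c *v (M *v (b *v du + dx - dxh)) + d *v du + dy) + du"
        "x = M *v (b *v u + dx)" "y = c *v x + d *v u + dy" "xh = M *v (b *v (u - du) + dxh)"
        using that unfolding sol b_def c_def d_def by blast+
      \<comment> \<open>The controller sees \<open>dx\<close> and \<open>dxh\<close> only through
        \<open>dx - dxh\<close>, hence the opposite signs.\<close>
      have u: "u = Tux *v dx + Tuu *v du + \<Phi>uy *v dy - Tux *v dxh"
        unfolding eqs(1) by (simp add: Tux_def Tuu_def matrix_vector_expand algebra_simps
            flip: matrix_vector_mul_assoc)
      show ?thesis
        unfolding eqs(2-4) u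
        by (simp add: G_def H_def matrix_vector_expand algebra_simps
            flip: matrix_vector_mul_assoc)
    qed
    show "\<exists>Txx\<in>RH_inf. \<exists>Txu\<in>RH_inf. \<exists>Txy\<in>RH_inf. \<exists>Txh\<in>RH_inf.
      \<exists>Tux\<in>RH_inf. \<exists>Tuu\<in>RH_inf. \<exists>Tuy\<in>RH_inf. \<exists>Tuh\<in>RH_inf.
      \<exists>Tyx\<in>RH_inf. \<exists>Tyu\<in>RH_inf. \<exists>Tyy\<in>RH_inf. \<exists>Tyh\<in>RH_inf.
      \<exists>Thx\<in>RH_inf. \<exists>Thu\<in>RH_inf. \<exists>Thy\<in>RH_inf. \<exists>Thh\<in>RH_inf.
      \<forall>dx du dy dxh x u y xh. of_loop A B C D \<Phi>uy dx du dy dxh x u y xh \<longrightarrow>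
        x = Txx *v dx + Txu *v du + Txy *v dy + Txh *v dxh \<and>
        u = Tux *v dx + Tuu *v du + Tuy *v dy + Tuh *v dxh \<and>
        y = Tyx *v dx + Tyu *v du + Tyy *v dy + Tyh *v dxh \<and>
        xh = Thx *v dx + Thu *v du + Thy *v dy + Thh *v dxh"
      by (rule bexI[where x = "G ** Tux + M"], rule bexI[where x = "G ** Tuu"],
          rule bexI[where x = "G ** \<Phi>uy"], rule bexI[where x = "- (G ** Tux)"],
          rule bexI[where x = Tux], rule bexI[where x = Tuu],
          rule bexI[where x = \<Phi>uy], rule bexI[where x = "- Tux"],
          rule bexI[where x = "H ** Tux + c ** M"], rule bexI[where x = "H ** Tuu"],
          rule bexI[where x = "H ** \<Phi>uy + mat 1"], rule bexI[where x = "- (H ** Tux)"],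
          rule bexI[where x = "G ** Tux"], rule bexI[where x = "G ** Tuu - G"],
          rule bexI[where x = "G ** \<Phi>uy"], rule bexI[where x = "M - G ** Tux"],
          use resp in blast)
        (intro RH_inf_intros M \<Phi> mem)+
  qed
qed

theorem theorem1:
  fixes A :: "real ^ 'nx ^ 'nx" and B :: "real ^ 'nu ^ 'nx"
    and C :: "real ^ 'nx ^ 'ny" and D :: "real ^ 'nu ^ 'ny"
  assumes "Schur_stable A"
  shows "(\<forall>\<Phi>x \<Phi>u. sf_feasible A B \<Phi>x \<Phi>u \<longrightarrow> sf_internally_stabilizing A B \<Phi>u) \<and>
         (\<forall>\<Phi>xx \<Phi>ux \<Phi>xy \<Phi>uy. of_feasible A B C \<Phi>xx \<Phi>ux \<Phi>xy \<Phi>uy \<longrightarrow>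
            of_internally_stabilizing A B C D \<Phi>uy)"
  \<comment> \<open>Feasibility places \<open>\<Phi>u\<close> in \<open>zinv_RH_inf\<close> and
    \<open>\<Phi>uy\<close> in \<open>RH_inf\<close>.\<close>
  using assms sf_internally_stabilizing_if_stable of_internally_stabilizing_if_stable
  by (auto simp: sf_feasible_def of_feasible_def)

end
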